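(* If $(V,\omega)$ is a finite-dimensional symplectic $\mathcal{R}^{(2)}$-module, then $\dim_{\mathcal{R}^{(2)}}(V)=(2n,2m)$ for some non-negative integers $n$ and $m$, and there exists a $(\mathcal{R}^{(2)},\mathcal{R})$-basis $(e_1,f_1,\dots,e_n,f_n\,\|\,e_{n+1},f_{n+1},\dots,e_{n+m},f_{n+m})$ of $V$ such that (i) $\omega(e_i,f_i)=1$ for $1\le i\le n$; (ii) $\omega(e_{n+j},f_{n+j})=1^{\#}$ for $1\le j\le m$; (iii) $\omega(e_i,e_j)=0$ for $1\le i,j\le n+m$; (iv) $\omega(f_i,f_j)=0$ for $1\le i,j\le n+m$; (v) $\omega(e_i,f_j)=0$ for $1\le i,j\le n+m$ and $i\neq j$.
   Context: Let $\mathcal{R}$ be the field of real numbers. The dual real number algebra is the 2-dimensional commutative associative real algebra $\mathcal{R}^{(2)}=\mathcal{R}\oplus\mathcal{R}\,1^{\#}$ with basis $\{1,1^{\#}\}$ and product $(x_1+x_2 1^{\#})(y_1+y_2 1^{\#})=x_1y_1+(x_1y_2+x_2y_1)1^{\#}$ for $x_1,x_2,y_1,y_2\in\mathcal{R}$ (so $1^{\#}1^{\#}=0$); $\mathcal{R}$ is identified with the subalgebra $\mathcal{R}\cdot 1$. For $x=x_1+x_21^{\#}$ with $x_1,x_2\in\mathcal{R}$, $Re\,x:=x_1$. For an $\mathcal{R}^{(2)}$-module $V$, put $Im\,1^{\#}_V:=\{1^{\#}v\mid v\in V\}$ and $Ker\,1^{\#}_V:=\{v\in V \mid 1^{\#}v=0\}$.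 A $(\mathcal{R}^{(2)},\mathcal{R})$-basis for $V$ is a subset $\beta=(S_1\,\|\,S_2):=S_1\cup S_2$ of $V$ (with the decomposition into $S_1$ and $S_2$ being part of the data) such that: (i) $S_1\subseteq V$ and $S_2\subseteq Ker\,1^{\#}_V$; (ii) $\beta$ is $(\mathcal{R}^{(2)}\,\|\,\mathcal{R})$-linearly independent: for any finite families of distinct elements $v_1,\dots,v_s\in S_1$ and distinct elements $w_1,\dots,w_t\in S_2$, and any $c_1,\dots,c_s\in\mathcal{R}^{(2)}$ and $d_1,\dots,d_t\in\mathcal{R}$, the equality $\sum_{i=1}^s c_iv_i+\sum_{j=1}^t d_jw_j=0$ implies that all $c_i=0$ and all $d_j=0$; (iii) every $v\in V$ can be written as a finite sum $v=\sum_{i=1}^s c_iv_i+\sum_{j=1}^t d_jw_j$ with $v_i\in S_1$, $w_j\in S_2$, $c_i\in\mathcal{R}^{(2)}$ and $d_j\in\mathcal{R}$. If $V$ has a finite $(\mathcal{R}^{(2)},\mathcal{R})$-basis $(S_1\,\|\,S_2)$ with $|S_1|=p$ and $|S_2|=q$, then $V$ is called finite dimensional; the pair $(p,q)$ of nonnegative integers is unique, is called the $\mathcal{R}^{(2)}$-dimension of $V$, and is denoted $\dim_{\mathcal{R}^{(2)}}(V)=(p,q)$. A Hu-Liu symplectic form on an $\mathcal{R}^{(2)}$-module $V$ is a function $\omega:V\times V\to\mathcal{R}^{(2)}$ such that: (i) $\omega(x+y,z)=\omega(x,z)+\omega(y,z)$ for $x,y,z\in V$; (ii) $\omega(ax,y)=a\,\omega(x,y)$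 for $x,y\in V$ and $a\in\mathcal{R}^{(2)}$; (iii) $\omega(x,y)=-\omega(y,x)$ for $x,y\in V$; (iv) if $v\in V$ and $Re\,\omega(v,x)=0$ for all $x\in V$, then $v\in Ker\,1^{\#}_V$; (v) if $v\in Ker\,1^{\#}_V$ and $\omega(v,x)=0$ for all $x\in V$, then $v\in Im\,1^{\#}_V$. A symplectic $\mathcal{R}^{(2)}$-module is a pair $(V,\omega)$ where $V$ is an $\mathcal{R}^{(2)}$-module and $\omega$ is a Hu-Liu symplectic form on $V$. *)

theory Defs
  imports Complex_Main
begin

section \<open>The dual real number algebra\<close>

datatype dual_real = Dual (Re_part: real) (Sharp_part: real)

lemma dual_real_eq_iff:
  "x = y \<longleftrightarrow> Re_part x = Re_part y \<and> Sharp_part x = Sharp_part y"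
  by (cases x; cases y) simp

instantiation dual_real :: "{comm_ring_1, real_algebra_1}"
begin

definition "0 = Dual 0 0"
definition "1 = Dual 1 0"
definition "x + y = Dual (Re_part x + Re_part y) (Sharp_part x + Sharp_part y)"
definition "- x = Dual (- Re_part x) (- Sharp_part x)"
definition "x - y = Dual (Re_part x - Re_part y) (Sharp_part x - Sharp_part y)"
definition "x * y = Dual (Re_part x * Re_part y)
  (Re_part x * Sharp_part y + Sharp_part x * Re_part y)"
definition "r *\<^sub>R x = Dual (r * Re_part x) (r * Sharp_part x)"

instance
  by standard
    (simp_all add: dual_real_eq_iff zero_dual_real_def one_dual_real_def plus_dual_real_def
      uminus_dual_real_def minus_dual_real_def times_dual_real_def scaleR_dual_real_def
      algebra_simps)

end

lemma of_real_dual_real: "of_real r = Dual r 0"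
  by (simp add: of_real_def one_dual_real_def scaleR_dual_real_def)

definition sharp :: dual_real where
  "sharp = Dual 0 1"

lemma Dual_eq: "Dual a b = of_real a + of_real b * sharp"
  by (simp add: of_real_dual_real sharp_def plus_dual_real_def times_dual_real_def)

lemma sharp_sharp: "sharp * sharp = 0"
  by (simp add: sharp_def times_dual_real_def zero_dual_real_def)


section \<open>Modules over the dual real numbers\<close>

text \<open>A module over the dual real numbers is a scalar multiplication satisfying the predicate
  \<^const>\<open>module\<close>; the carrier is a whole type. Real numbers act through \<^const>\<open>of_real\<close>.\<close>

definition im_sharp :: "(dual_real \<Rightarrow> 'v \<Rightarrow> 'v) \<Rightarrow> 'v set" where
  "im_sharp scale = range (scale sharp)"

definition ker_sharp :: "(dual_real \<Rightarrow> 'v::ab_group_add \<Rightarrow> 'v) \<Rightarrow> 'v set" where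
  "ker_sharp scale = {v. scale sharp v = 0}"

text \<open>In the next definition the two sums are kept separate, so that an element common to
  \<open>S1\<close> and \<open>S2\<close> would receive two independent coefficients.\<close>

definition dual_independent ::
  "(dual_real \<Rightarrow> 'v::ab_group_add \<Rightarrow> 'v) \<Rightarrow> 'v set \<Rightarrow> 'v set \<Rightarrow> bool" where
  "dual_independent scale S1 S2 \<longleftrightarrow>
    (\<forall>F1 F2 (c :: 'v \<Rightarrow> dual_real) (d :: 'v \<Rightarrow> real).
      finite F1 \<longrightarrow> F1 \<subseteq> S1 \<longrightarrow> finite F2 \<longrightarrow> F2 \<subseteq> S2 \<longrightarrow>
      (\<Sum>v\<in>F1. scale (c v) v) + (\<Sum>w\<in>F2. scale (of_real (d w)) w) = 0 \<longrightarrow>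
      (\<forall>v\<in>F1. c v = 0) \<and> (\<forall>w\<in>F2. d w = 0))"

definition dual_spanning ::
  "(dual_real \<Rightarrow> 'v::ab_group_add \<Rightarrow> 'v) \<Rightarrow> 'v set \<Rightarrow> 'v set \<Rightarrow> bool" where
  "dual_spanning scale S1 S2 \<longleftrightarrow>
    (\<forall>u. \<exists>F1 F2 (c :: 'v \<Rightarrow> dual_real) (d :: 'v \<Rightarrow> real).
      finite F1 \<and> F1 \<subseteq> S1 \<and> finite F2 \<and> F2 \<subseteq> S2 \<and>
      u = (\<Sum>v\<in>F1. scale (c v) v) + (\<Sum>w\<in>F2. scale (of_real (d w)) w))"

definition dual_basis ::
  "(dual_real \<Rightarrow> 'v::ab_group_add \<Rightarrow> 'v) \<Rightarrow> 'v set \<Rightarrow> 'v set \<Rightarrow> bool" where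
  "dual_basis scale S1 S2 \<longleftrightarrow>
    S2 \<subseteq> ker_sharp scale \<and> dual_independent scale S1 S2 \<and> dual_spanning scale S1 S2"

definition dual_finite_dimensional :: "(dual_real \<Rightarrow> 'v::ab_group_add \<Rightarrow> 'v) \<Rightarrow> bool" where
  "dual_finite_dimensional scale \<longleftrightarrow>
    (\<exists>S1 S2. dual_basis scale S1 S2 \<and> finite S1 \<and> finite S2)"

text \<open>Meaningful for finite dimensional modules only.\<close>

definition dual_dim :: "(dual_real \<Rightarrow> 'v::ab_group_add \<Rightarrow> 'v) \<Rightarrow> nat \<times> nat" where
  "dual_dim scale = (THE pq. \<exists>S1 S2. dual_basis scale S1 S2 \<and> finite S1 \<and> finite S2 \<and>
    pq = (card S1, card S2))"


section \<open>Hu-Liu symplectic forms\<close>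

locale symplectic_dual_module = module scale
  for scale :: "dual_real \<Rightarrow> 'v::ab_group_add \<Rightarrow> 'v" +
  fixes \<omega> :: "'v \<Rightarrow> 'v \<Rightarrow> dual_real"
  assumes add_left: "\<omega> (x + y) z = \<omega> x z + \<omega> y z"
    and scale_left: "\<omega> (scale a x) y = a * \<omega> x y"
    and skew: "\<omega> x y = - \<omega> y x"
    and Re_radical: "(\<And>x. Re_part (\<omega> v x) = 0) \<Longrightarrow> v \<in> ker_sharp scale"
    and ker_radical: "v \<in> ker_sharp scale \<Longrightarrow> (\<And>x. \<omega> v x = 0) \<Longrightarrow> v \<in> im_sharp scale"

end

theory Submission
  imports Defs
begin

text \<open>
  The proof is a symplectic Gram-Schmidt process run in two rounds.

  As long as two vectors \<open>a, b\<close> orthogonal to the pairs already chosen satisfy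
  \<open>Re \<omega>(a, b) \<noteq> 0\<close>, the dual number \<open>\<omega>(a, b)\<close> is invertible, so \<open>a\<close> can be rescaled to give a
  new pair with \<open>\<omega>(e, f) = 1\<close>. When no such vectors are left, the orthogonal complement of the
  pairs lies in the kernel of \<open>1\<^sup>#\<close>: each of its vectors has \<open>Re \<omega>(u, x) = 0\<close> for every \<open>x\<close>, and
  axiom (iv) applies (\<open>orthogonal_subset_ker\<close>). On this kernel part all values of \<open>\<omega>\<close> are real
  multiples of \<open>1\<^sup>#\<close>, and two vectors with \<open>\<omega>(a, b) \<noteq> 0\<close> can be rescaled by a real number to give
  a pair with \<open>\<omega>(e, f) = 1\<^sup>#\<close>.

  At every stage the chosen vectors are independent and split off as an orthogonal direct summand,
  because each has a partner, up to sign the other vector of its pair, that reads off its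
  coefficient (\<open>form_combination_partner\<close>, \<open>partnered_decomposition\<close>). Independence bounds the
  number of pairs by the real dimension of \<open>V\<close>, so both rounds stop. Then \<open>\<omega>\<close> vanishes on the
  remaining complement, whose vectors are therefore orthogonal to all of \<open>V\<close>. Axioms (iv) and (v)
  together make \<open>\<omega>\<close> nondegenerate (\<open>nondegenerate\<close>), so the complement is zero and the chosen
  vectors form a basis (\<open>darboux_basis\<close>).

  That the dimension is well defined follows from real linear algebra: a basis \<open>(S1 \<parallel> S2)\<close> yields
  the real basis \<open>S1 \<union> 1\<^sup>#S1 \<union> S2\<close> of \<open>V\<close> and the real basis \<open>1\<^sup>#S1\<close> of the image of \<open>1\<^sup>#\<close>, so the
  real dimensions of these two spaces determine both cardinalities (\<open>dual_basis_real_dim\<close>).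
\<close>

section \<open>Arithmetic of dual numbers\<close>

lemma dual_real_simps [simp]:
  "Re_part 0 = 0" "Sharp_part 0 = 0"
  "Re_part 1 = 1" "Sharp_part 1 = 0"
  "Re_part sharp = 0" "Sharp_part sharp = 1"
  "Re_part (of_real r) = r" "Sharp_part (of_real r) = 0"
  "Re_part (x + y) = Re_part x + Re_part y" "Sharp_part (x + y) = Sharp_part x + Sharp_part y"
  "Re_part (- x) = - Re_part x" "Sharp_part (- x) = - Sharp_part x"
  "Re_part (x - y) = Re_part x - Re_part y" "Sharp_part (x - y) = Sharp_part x - Sharp_part y"
  "Re_part (x * y) = Re_part x * Re_part y"
  "Sharp_part (x * y) = Re_part x * Sharp_part y + Sharp_part x * Re_part y"
  by (simp_all add: zero_dual_real_def one_dual_real_def sharp_def of_real_dual_real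
      plus_dual_real_def uminus_dual_real_def minus_dual_real_def times_dual_real_def)

lemma sharp_neq [simp]: "sharp \<noteq> 0" "sharp \<noteq> 1" "1 \<noteq> sharp"
  by (simp_all add: dual_real_eq_iff)

lemma sharp_mult_eq_0_iff: "sharp * x = 0 \<longleftrightarrow> Re_part x = 0"
  by (simp add: dual_real_eq_iff)

lemma eq_of_real_mult_sharp: "Re_part x = 0 \<Longrightarrow> x = of_real (Sharp_part x) * sharp"
  by (simp add: dual_real_eq_iff)

lemma left_inverse_exists:
  assumes "Re_part x \<noteq> 0"
  shows "\<exists>y. y * x = 1"
proof
  \<comment> \<open>\<open>(a + b 1\<^sup>#)\<inverse> = (a - b 1\<^sup>#) / a\<^sup>2\<close>, because \<open>1\<^sup>#1\<^sup># = 0\<close>\<close>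
  show "Dual (1 / Re_part x) (- Sharp_part x / (Re_part x)\<^sup>2) * x = 1"
    using assms by (simp add: dual_real_eq_iff field_simps power2_eq_square)
qed


section \<open>The dimension of a module over the dual numbers\<close>

locale dual_module = module scale
  for scale :: "dual_real \<Rightarrow> 'v::ab_group_add \<Rightarrow> 'v"

sublocale dual_module \<subseteq> over_real: vector_space "\<lambda>r. scale (of_real r)"
  by unfold_locales (simp_all add: scale_left_distrib scale_right_distrib)

lemma dual_independentD:
  assumes "dual_independent scale S1 S2" "finite F1" "F1 \<subseteq> S1" "finite F2" "F2 \<subseteq> S2"
    and "(\<Sum>v\<in>F1. scale (c v) v) + (\<Sum>w\<in>F2. scale (of_real (d w)) w) = 0"
  shows "v \<in> F1 \<Longrightarrow> c v = 0" "w \<in> F2 \<Longrightarrow> d w = 0"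
  using assms unfolding dual_independent_def by blast+

lemma dual_spanningE:
  assumes "dual_spanning scale S1 S2"
  obtains F1 F2 c d where "F1 \<subseteq> S1" "F2 \<subseteq> S2"
    "u = (\<Sum>v\<in>F1. scale (c v) v) + (\<Sum>w\<in>F2. scale (of_real (d w)) w)"
  using spec[OF assms[unfolded dual_spanning_def], of u] by (elim exE conjE)

context dual_module
begin

text \<open>A real relation among \<open>S1\<close>, \<open>1\<^sup>#S1\<close> and \<open>S2\<close> is a dual relation in disguise: the real
  coefficients of \<open>v\<close> and \<open>1\<^sup>#v\<close> are the two components of one dual coefficient of \<open>v\<close>. That the
  three sets do not overlap and that \<open>1\<^sup>#\<close> is injective on \<open>S1\<close> comes from relations with at most
  two terms.\<close>

lemma real_independent_of_dual_independent:
  assumes ind: "dual_independent scale S1 S2" and fin: "finite S1" "finite S2"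
  shows "inj_on (scale sharp) S1"
    and "over_real.independent (S1 \<union> scale sharp ` S1 \<union> S2)"
    and "card (S1 \<union> scale sharp ` S1 \<union> S2) = 2 * card S1 + card S2"
proof -
  note D = dual_independentD[OF ind]
  show inj: "inj_on (scale sharp) S1"
  proof (rule inj_onI, rule ccontr)
    fix v w assume vw: "v \<in> S1" "w \<in> S1" "scale sharp v = scale sharp w" "v \<noteq> w"
    have "(\<Sum>x\<in>{v, w}. scale (if x = v then sharp else - sharp) x)
        + (\<Sum>x\<in>{}. scale (of_real 0) x) = 0"
      using vw by simp
    then show False
      using D(1)[of "{v, w}" "{}" "\<lambda>x. if x = v then sharp else - sharp" "\<lambda>_. 0" v] vw by simp
  qed
  have nonzero: "scale sharp v \<noteq> 0" if "v \<in> S1" for v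
    using D(1)[of "{v}" "{}" "\<lambda>_. sharp" "\<lambda>_. 0" v] that by auto
  have disj1: "S1 \<inter> scale sharp ` S1 = {}"
    using nonzero by (force simp: sharp_sharp)
  have disj2: "(S1 \<union> scale sharp ` S1) \<inter> S2 = {}"
  proof -
    have "scale c v \<noteq> w" if "v \<in> S1" "w \<in> S2" for v w c
      using D(2)[of "{v}" "{w}" "\<lambda>_. c" "\<lambda>_. - 1" w] that by auto
    from this[where c = 1] this[where c = sharp] show ?thesis by auto
  qed
  have sum_split: "sum g (S1 \<union> scale sharp ` S1 \<union> S2)
      = (\<Sum>v\<in>S1. g v + g (scale sharp v)) + sum g S2" for g :: "'v \<Rightarrow> 'w::comm_monoid_add"
    using fin disj1 disj2 inj by (simp add: sum.union_disjoint sum.reindex sum.distrib)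
  show "card (S1 \<union> scale sharp ` S1 \<union> S2) = 2 * card S1 + card S2"
    using fin disj1 disj2 inj by (simp add: card_Un_disjoint card_image)
  show "over_real.independent (S1 \<union> scale sharp ` S1 \<union> S2)"
  proof -
    have "\<forall>b\<in>S1 \<union> scale sharp ` S1 \<union> S2. u b = 0"
      if "(\<Sum>b\<in>S1 \<union> scale sharp ` S1 \<union> S2. scale (of_real (u b)) b) = 0" for u
    proof -
      define c where "c v = of_real (u v) + of_real (u (scale sharp v)) * sharp" for v
      have "(\<Sum>v\<in>S1. scale (c v) v) + (\<Sum>w\<in>S2. scale (of_real (u w)) w) = 0"
        using that unfolding sum_split c_def by (simp add: scale_left_distrib)
      from D[OF fin(1) order_refl fin(2) order_refl this]
      have "\<forall>v\<in>S1. c v = 0" "\<forall>w\<in>S2. u w = 0" by auto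
      then show ?thesis
        by (auto simp: c_def dual_real_eq_iff)
    qed
    then show ?thesis
      using fin by (subst over_real.dependent_finite) auto
  qed
qed

text \<open>Multiplication by \<open>1\<^sup>#\<close> kills \<open>S2\<close> and the \<open>1\<^sup>#\<close>-components of the coefficients on \<open>S1\<close>, which
  leaves \<open>1\<^sup>#S1\<close> as a real basis of the image. Neither of the two real dimensions depends on the
  basis, hence neither do \<open>card S1\<close> and \<open>card S2\<close>.\<close>

lemma dual_basis_real_dim:
  assumes basis: "dual_basis scale S1 S2" and fin: "finite S1" "finite S2"
  shows "over_real.dim (im_sharp scale) = card S1"
    and "over_real.span (S1 \<union> scale sharp ` S1 \<union> S2) = UNIV"
    and "over_real.dim UNIV = 2 * card S1 + card S2"
proof -
  have ind: "dual_independent scale S1 S2" and sp: "dual_spanning scale S1 S2"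
    and ker: "S2 \<subseteq> ker_sharp scale"
    using basis by (auto simp: dual_basis_def)
  note R = real_independent_of_dual_independent[OF ind fin]
  have scale_split: "scale x v = scale (of_real (Re_part x)) v
      + scale (of_real (Sharp_part x)) (scale sharp v)" for x v
  proof -
    have "x = of_real (Re_part x) + of_real (Sharp_part x) * sharp"
      by (simp add: dual_real_eq_iff)
    from arg_cong[OF this, of "\<lambda>c. scale c v"] show ?thesis
      by (simp only: scale_left_distrib scale_scale)
  qed
  let ?B = "S1 \<union> scale sharp ` S1 \<union> S2"
  show span: "over_real.span ?B = UNIV"
  proof (intro equalityI subset_UNIV subsetI)
    fix u
    obtain F1 F2 c d where F: "F1 \<subseteq> S1" "F2 \<subseteq> S2"
      and u: "u = (\<Sum>v\<in>F1. scale (c v) v) + (\<Sum>w\<in>F2. scale (of_real (d w)) w)"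
      using dual_spanningE[OF sp] .
    have "scale (c v) v \<in> over_real.span ?B" if "v \<in> F1" for v
      unfolding scale_split[of "c v" v] using that F
      by (intro over_real.span_add over_real.span_scale over_real.span_base) auto
    moreover have "scale (of_real (d w)) w \<in> over_real.span ?B" if "w \<in> F2" for w
      using that F by (intro over_real.span_scale over_real.span_base) auto
    ultimately show "u \<in> over_real.span ?B"
      unfolding u by (intro over_real.span_add over_real.span_sum) auto
  qed
  show "over_real.dim UNIV = 2 * card S1 + card S2"
    by (rule over_real.dim_unique[OF _ _ R(2,3)]) (auto simp: span)
  show "over_real.dim (im_sharp scale) = card S1"
  proof (rule over_real.dim_unique)
    show "scale sharp ` S1 \<subseteq> im_sharp scale" by (auto simp: im_sharp_def)
    show "over_real.independent (scale sharp ` S1)"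
      by (rule over_real.independent_mono[OF R(2)]) auto
    show "card (scale sharp ` S1) = card S1" by (rule card_image[OF R(1)])
    show "im_sharp scale \<subseteq> over_real.span (scale sharp ` S1)"
    proof (clarsimp simp: im_sharp_def)
      fix u
      obtain F1 F2 c d where F: "F1 \<subseteq> S1" "F2 \<subseteq> S2"
        and u: "u = (\<Sum>v\<in>F1. scale (c v) v) + (\<Sum>w\<in>F2. scale (of_real (d w)) w)"
        using dual_spanningE[OF sp] .
      have 1: "scale sharp (scale (c v) v) = scale (of_real (Re_part (c v))) (scale sharp v)" for v
      proof -
        have "sharp * c v = of_real (Re_part (c v)) * sharp"
          by (simp add: dual_real_eq_iff)
        then show ?thesis by (simp only: scale_scale)
      qed
      have 2: "scale sharp (scale (of_real (d w)) w) = 0" if "w \<in> F2" for w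
      proof -
        have "scale sharp w = 0" using that F ker by (auto simp: ker_sharp_def)
        then show ?thesis by (simp only: scale_left_commute[of sharp] scale_zero_right)
      qed
      have "scale sharp u = (\<Sum>v\<in>F1. scale (of_real (Re_part (c v))) (scale sharp v))"
        unfolding u scale_right_distrib scale_sum_right 1 by (simp add: 2 del: scale_scale)
      also have "\<dots> \<in> over_real.span (scale sharp ` S1)"
        using F by (intro over_real.span_sum over_real.span_scale over_real.span_base) auto
      finally show "scale sharp u \<in> over_real.span (scale sharp ` S1)" .
    qed
  qed
qed

lemma dual_dim_eq:
  assumes "dual_basis scale S1 S2" "finite S1" "finite S2"
  shows "dual_dim scale = (card S1, card S2)"
  unfolding dual_dim_def
proof (rule the_equality)
  fix pq assume "\<exists>S1 S2. dual_basis scale S1 S2 \<and> finite S1 \<and> finite S2 \<and> pq = (card S1, card S2)"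
  then obtain T1 T2 where T: "dual_basis scale T1 T2" "finite T1" "finite T2"
    and pq: "pq = (card T1, card T2)" by blast
  have 1: "card T1 = card S1"
    using dual_basis_real_dim(1)[OF T] dual_basis_real_dim(1)[OF assms] by (rule trans[OF sym])
  have "2 * card T1 + card T2 = 2 * card S1 + card S2"
    using dual_basis_real_dim(3)[OF T] dual_basis_real_dim(3)[OF assms] by (rule trans[OF sym])
  with 1 show "pq = (card S1, card S2)" unfolding pq by simp
next
  show "\<exists>S1' S2'. dual_basis scale S1' S2' \<and> finite S1' \<and> finite S2' \<and>
      (card S1, card S2) = (card S1', card S2')"
    by (rule exI[of _ S1], rule exI[of _ S2]) (simp add: assms)
qed

text \<open>This bound is what makes the Gram-Schmidt process stop.\<close>

lemma dual_independent_card_bound: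
  assumes "dual_finite_dimensional scale"
  shows "\<exists>N. \<forall>S1 S2. dual_independent scale S1 S2 \<longrightarrow> finite S1 \<longrightarrow> finite S2 \<longrightarrow>
    2 * card S1 + card S2 \<le> N"
proof -
  obtain T1 T2 where T: "dual_basis scale T1 T2" "finite T1" "finite T2"
    using assms unfolding dual_finite_dimensional_def by blast
  let ?B = "T1 \<union> scale sharp ` T1 \<union> T2"
  have "2 * card S1 + card S2 \<le> card ?B"
    if S: "dual_independent scale S1 S2" "finite S1" "finite S2" for S1 S2
  proof -
    have "finite ?B" using T by simp
    moreover note real_independent_of_dual_independent(2)[OF S]
    moreover have "S1 \<union> scale sharp ` S1 \<union> S2 \<subseteq> over_real.span ?B"
      unfolding dual_basis_real_dim(2)[OF T] by (rule subset_UNIV)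
    ultimately show ?thesis
      using over_real.independent_span_bound real_independent_of_dual_independent(3)[OF S] by metis
  qed
  then show ?thesis by blast
qed

end


section \<open>Elementary properties of Hu-Liu symplectic forms\<close>

sublocale symplectic_dual_module \<subseteq> dual_module ..

context symplectic_dual_module
begin

lemma scale_right: "\<omega> x (scale a y) = a * \<omega> x y"
  unfolding skew[of x "scale a y"] skew[of x y] scale_left by simp

lemma add_right: "\<omega> x (y + z) = \<omega> x y + \<omega> x z"
  unfolding skew[of x "y + z"] skew[of x y] skew[of x z] add_left by simp

lemma zero_left [simp]: "\<omega> 0 y = 0"
  using scale_left[of 0 0 y] by simp

lemma zero_right [simp]: "\<omega> x 0 = 0"
  using scale_right[of x 0 0] by simp

lemma minus_right: "\<omega> x (- y) = - \<omega> x y"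
proof -
  have "\<omega> x y + \<omega> x (- y) = 0"
    unfolding add_right[symmetric] by simp
  then show ?thesis by (rule minus_unique[symmetric])
qed

lemma diff_left: "\<omega> (x - y) z = \<omega> x z - \<omega> y z"
  using add_left[of "x - y" y z] by simp

lemma sum_left: "\<omega> (\<Sum>i\<in>A. g i) y = (\<Sum>i\<in>A. \<omega> (g i) y)"
  by (induction A rule: infinite_finite_induct) (simp_all add: add_left)

lemma sum_right: "\<omega> x (\<Sum>i\<in>A. g i) = (\<Sum>i\<in>A. \<omega> x (g i))"
  by (induction A rule: infinite_finite_induct) (simp_all add: add_right)

lemma alternating [simp]: "\<omega> x x = 0"
proof -
  have "a = - a \<Longrightarrow> a = 0" for a :: dual_real
    by (simp add: dual_real_eq_iff)
  then show ?thesis using skew[of x x] by blast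
qed

lemma eq_0_sym: "\<omega> x y = 0 \<longleftrightarrow> \<omega> y x = 0"
  using skew[of x y] by simp

lemma Re_form_ker:
  assumes "y \<in> ker_sharp scale"
  shows "Re_part (\<omega> x y) = 0"
  using assms scale_right[of x sharp y] by (simp add: ker_sharp_def flip: sharp_mult_eq_0_iff)

text \<open>Axioms (iv) and (v) put a vector \<open>v\<close> of the radical into the image of \<open>1\<^sup>#\<close>. For \<open>v = 1\<^sup>#u\<close> the
  condition \<open>1\<^sup>#\<omega>(u, x) = 0\<close> says \<open>Re \<omega>(u, x) = 0\<close>, so axiom (iv), now applied to \<open>u\<close>, gives
  \<open>v = 1\<^sup>#u = 0\<close>.\<close>

lemma nondegenerate:
  assumes "\<And>x. \<omega> v x = 0"
  shows "v = 0"
proof -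
  have "v \<in> ker_sharp scale" using assms by (intro Re_radical) simp
  then have "v \<in> im_sharp scale" using assms by (rule ker_radical)
  then obtain u where u: "v = scale sharp u" by (auto simp: im_sharp_def)
  have "u \<in> ker_sharp scale"
    using assms unfolding u scale_left sharp_mult_eq_0_iff by (rule Re_radical)
  then show ?thesis by (simp add: u ker_sharp_def)
qed


section \<open>Families with orthogonal partners\<close>

text \<open>The map \<open>p\<close> plays the role of a dual basis: pairing with \<open>p b\<close> extracts the coefficient of \<open>b\<close>,
  times \<open>1\<^sup>#\<close> if \<open>b \<in> S2\<close>.
  Partners of elements of \<open>S2\<close> have to lie in the kernel of \<open>1\<^sup>#\<close>, so that pairing an arbitrary
  vector with them gives a real multiple of \<open>1\<^sup>#\<close>, which a real coefficient on \<open>S2\<close> can match.\<close>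

definition partnered :: "'v set \<Rightarrow> 'v set \<Rightarrow> ('v \<Rightarrow> 'v) \<Rightarrow> bool" where
  "partnered S1 S2 p \<longleftrightarrow> finite S1 \<and> finite S2 \<and> p ` S2 \<subseteq> ker_sharp scale \<and>
    (\<forall>b\<in>S1. \<omega> b (p b) = 1) \<and> (\<forall>b\<in>S2. \<omega> b (p b) = sharp) \<and>
    (\<forall>b\<in>S1 \<union> S2. \<forall>b'\<in>S1 \<union> S2. b' \<noteq> b \<longrightarrow> \<omega> b' (p b) = 0)"

lemma partnered_disjoint:
  assumes "partnered S1 S2 p"
  shows "S1 \<inter> S2 = {}"
  using assms sharp_neq(3) unfolding partnered_def by (metis disjoint_iff)

lemma form_combination_partner:
  assumes p: "partnered S1 S2 p" and F: "F1 \<subseteq> S1" "F2 \<subseteq> S2" and b: "b \<in> S1 \<union> S2"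
  shows "\<omega> ((\<Sum>v\<in>F1. scale (c v) v) + (\<Sum>w\<in>F2. scale (of_real (d w)) w)) (p b)
    = (if b \<in> F1 then c b else if b \<in> F2 then of_real (d b) * sharp else 0)"
proof -
  have fin: "finite F1" "finite F2"
    using p F by (auto simp: partnered_def intro: finite_subset)
  have disj: "\<not> (b \<in> S1 \<and> b \<in> S2)"
    using partnered_disjoint[OF p] by blast
  have 1: "c v * \<omega> v (p b) = (if v = b then c b else 0)" if "v \<in> F1" for v
    using that p F b by (auto simp: partnered_def)
  have 2: "of_real (d w) * \<omega> w (p b) = (if w = b then of_real (d b) * sharp else 0)"
    if "w \<in> F2" for w
    using that p F b disj by (auto simp: partnered_def)
  show ?thesis
    using fin disj F by (auto simp: add_left sum_left scale_left 1 2)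
qed

lemma partnered_independent:
  assumes p: "partnered S1 S2 p"
  shows "dual_independent scale S1 S2"
  unfolding dual_independent_def
proof (intro allI impI)
  fix F1 F2 c d
  assume F: "F1 \<subseteq> S1" "F2 \<subseteq> S2"
    and sum: "(\<Sum>v\<in>F1. scale (c v) v) + (\<Sum>w\<in>F2. scale (of_real (d w)) w) = 0"
  have *: "(if b \<in> F1 then c b else if b \<in> F2 then of_real (d b) * sharp else 0) = 0"
    if "b \<in> S1 \<union> S2" for b
    using form_combination_partner[OF p F that, of c d] unfolding sum by simp
  have 1: "\<forall>v\<in>F1. c v = 0"
  proof
    fix v assume "v \<in> F1"
    then show "c v = 0" using *[of v] F by auto
  qed
  have "\<forall>w\<in>F2. d w = 0"
  proof
    fix w assume w: "w \<in> F2"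
    then have "w \<notin> F1" using partnered_disjoint[OF p] F by blast
    then show "d w = 0" using *[of w] w F by (auto simp: dual_real_eq_iff)
  qed
  with 1 show "(\<forall>v\<in>F1. c v = 0) \<and> (\<forall>w\<in>F2. d w = 0)" ..
qed

text \<open>Orthogonal projection: the coefficients of \<open>v\<close> are read off with the partners, and \<open>u\<close> is what
  remains.\<close>

lemma partnered_decomposition:
  assumes p: "partnered S1 S2 p"
  obtains c d u where
    "v = (\<Sum>b\<in>S1. scale (c b) b) + (\<Sum>b\<in>S2. scale (of_real (d b)) b) + u"
    "\<And>b. b \<in> S1 \<union> S2 \<Longrightarrow> \<omega> u (p b) = 0"
proof -
  let ?comb = "(\<Sum>b\<in>S1. scale (\<omega> v (p b)) b)
    + (\<Sum>b\<in>S2. scale (of_real (Sharp_part (\<omega> v (p b)))) b)"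
  have "\<omega> (v - ?comb) (p b) = 0" if b: "b \<in> S1 \<union> S2" for b
  proof -
    have "Re_part (\<omega> v (p b)) = 0" if "b \<in> S2"
      using p that by (intro Re_form_ker) (auto simp: partnered_def)
    then show ?thesis
      using b eq_of_real_mult_sharp[of "\<omega> v (p b)"]
      by (auto simp: diff_left form_combination_partner[OF p order_refl order_refl b])
  qed
  moreover have "v = ?comb + (v - ?comb)" by simp
  ultimately show thesis by (intro that[of _ _ "v - ?comb"])
qed


section \<open>Darboux systems\<close>

text \<open>The configuration of vectors in the theorem, without the requirement that it be a basis. The
  kernel condition for the indices above \<open>n\<close> is kept explicitly, since it makes those vectors
  admissible as the part of a basis that has real coefficients.\<close>

definition darboux :: "nat \<Rightarrow> nat \<Rightarrow> (nat \<Rightarrow> 'v) \<Rightarrow> (nat \<Rightarrow> 'v) \<Rightarrow> bool" where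
  "darboux n m e f \<longleftrightarrow>
    (\<forall>i\<in>{n+1..n+m}. e i \<in> ker_sharp scale \<and> f i \<in> ker_sharp scale) \<and>
    (\<forall>i\<in>{1..n+m}. \<omega> (e i) (f i) = (if i \<le> n then 1 else sharp)) \<and>
    (\<forall>i\<in>{1..n+m}. \<forall>j\<in>{1..n+m}. \<omega> (e i) (e j) = 0 \<and> \<omega> (f i) (f j) = 0 \<and>
      (i \<noteq> j \<longrightarrow> \<omega> (e i) (f j) = 0))"

definition orthogonal :: "nat \<Rightarrow> (nat \<Rightarrow> 'v) \<Rightarrow> (nat \<Rightarrow> 'v) \<Rightarrow> 'v set" where
  "orthogonal k e f = {u. \<forall>i\<in>{1..k}. \<omega> u (e i) = 0 \<and> \<omega> u (f i) = 0}"

text \<open>Coinciding vectors would pair equally with everything, but \<open>\<omega>(e\<^sub>i, f\<^sub>i) \<noteq> 0\<close> while \<open>f\<^sub>i\<close> is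
  orthogonal to every vector of the system except \<open>e\<^sub>i\<close>, and vice versa.\<close>

lemma darboux_distinct:
  assumes D: "darboux n m e f"
  shows "inj_on e {1..n+m}" "inj_on f {1..n+m}" "e ` {1..n+m} \<inter> f ` {1..n+m} = {}"
proof -
  let ?K = "{1..n+m}"
  have pair: "\<omega> (e i) (f i) \<noteq> 0" if "i \<in> ?K" for i
    using D that by (auto simp: darboux_def)
  have ef: "\<omega> (e i) (f j) = 0" if "i \<in> ?K" "j \<in> ?K" "i \<noteq> j" for i j
    using D that by (auto simp: darboux_def)
  have ff: "\<omega> (f i) (f j) = 0" if "i \<in> ?K" "j \<in> ?K" for i j
    using D that by (auto simp: darboux_def)
  show "inj_on e ?K"
  proof (rule inj_onI, rule ccontr)
    fix i j assume ij: "i \<in> ?K" "j \<in> ?K" "e i = e j" "i \<noteq> j"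
    then show False using pair[of i] ef[of j i] by simp
  qed
  show "inj_on f ?K"
  proof (rule inj_onI, rule ccontr)
    fix i j assume ij: "i \<in> ?K" "j \<in> ?K" "f i = f j" "i \<noteq> j"
    then show False using pair[of i] ef[of i j] by simp
  qed
  have "e i \<noteq> f j" if "i \<in> ?K" "j \<in> ?K" for i j
    using pair[OF that(1)] ff[OF that(2,1)] by metis
  then show "e ` ?K \<inter> f ` ?K = {}" by blast
qed

text \<open>The partner of \<open>e\<^sub>i\<close> is \<open>f\<^sub>i\<close>, and by skew symmetry that of \<open>f\<^sub>i\<close> is \<open>- e\<^sub>i\<close>. Up to sign the partners
  are the system itself, so being orthogonal to the partners is being orthogonal to the system.\<close>

lemma darboux_partnered:
  assumes D: "darboux n m e f"
  obtains p where
    "partnered (e ` {1..n} \<union> f ` {1..n}) (e ` {n+1..n+m} \<union> f ` {n+1..n+m}) p"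
    "\<And>u. (\<And>b. b \<in> e ` {1..n+m} \<union> f ` {1..n+m} \<Longrightarrow> \<omega> u (p b) = 0) \<Longrightarrow> u \<in> orthogonal (n+m) e f"
proof -
  let ?K = "{1..n+m}"
  have pair: "\<omega> (e i) (f i) = (if i \<le> n then 1 else sharp)" if "i \<in> ?K" for i
    using D that by (auto simp: darboux_def)
  have ee: "\<omega> (e i) (e j) = 0" and ff: "\<omega> (f i) (f j) = 0" if "i \<in> ?K" "j \<in> ?K" for i j
    using D that by (auto simp: darboux_def)
  have ef: "\<omega> (e i) (f j) = 0" if "i \<in> ?K" "j \<in> ?K" "i \<noteq> j" for i j
    using D that by (auto simp: darboux_def)
  define p where "p b = (if b \<in> e ` ?K then f (inv_into ?K e b) else - e (inv_into ?K f b))" for b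
  have pe: "p (e i) = f i" if "i \<in> ?K" for i
    unfolding p_def inv_into_f_f[OF darboux_distinct(1)[OF D] that] using that by simp
  have pf: "p (f i) = - e i" if "i \<in> ?K" for i
  proof -
    have "f i \<notin> e ` ?K" using darboux_distinct(3)[OF D] that by blast
    then show ?thesis
      unfolding p_def inv_into_f_f[OF darboux_distinct(2)[OF D] that] by simp
  qed
  show thesis
  proof
    show "u \<in> orthogonal (n+m) e f"
      if "\<And>b. b \<in> e ` ?K \<union> f ` ?K \<Longrightarrow> \<omega> u (p b) = 0" for u
      unfolding orthogonal_def
    proof (intro CollectI ballI)
      fix i assume "i \<in> ?K"
      then show "\<omega> u (e i) = 0 \<and> \<omega> u (f i) = 0"
        using that[of "e i"] that[of "f i"] pe[of i] pf[of i] by (simp add: minus_right)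
    qed
    have union: "(e ` {1..n} \<union> f ` {1..n}) \<union> (e ` {n+1..n+m} \<union> f ` {n+1..n+m})
        = e ` ?K \<union> f ` ?K"
      by force
    have fe: "\<omega> (f i) (e i) = - (if i \<le> n then 1 else sharp)" if "i \<in> ?K" for i
      using skew[of "f i" "e i"] pair[OF that] by simp
    have fe0: "\<omega> (f i) (e j) = 0" if "i \<in> ?K" "j \<in> ?K" "i \<noteq> j" for i j
      using skew[of "f i" "e j"] ef[of j i] that by simp
    have ker: "e i \<in> ker_sharp scale" "f i \<in> ker_sharp scale" if "i \<in> {n+1..n+m}" for i
      using D that by (auto simp: darboux_def)
    have own: "\<omega> (e i) (p (e i)) = (if i \<le> n then 1 else sharp)"
      "\<omega> (f i) (p (f i)) = (if i \<le> n then 1 else sharp)" if "i \<in> ?K" for i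
      using that pe[of i] pf[of i] pair[of i] fe[of i] by (simp_all add: minus_right)
    have cross: "\<omega> b' (p b) = 0"
      if "b \<in> e ` ?K \<union> f ` ?K" "b' \<in> e ` ?K \<union> f ` ?K" "b' \<noteq> b" for b b'
    proof -
      have "\<exists>i\<in>?K. b = e i \<or> b = f i" "\<exists>j\<in>?K. b' = e j \<or> b' = f j"
        using \<open>b \<in> _\<close> \<open>b' \<in> _\<close> by blast+
      then obtain i j where "i \<in> ?K" "j \<in> ?K" "b = e i \<or> b = f i" "b' = e j \<or> b' = f j"
        by blast
      then show ?thesis
        using \<open>b' \<noteq> b\<close> pe[of i] pf[of i] ee[of j i] ff[of j i] ef[of j i] fe0[of j i]
        by (elim disjE) (auto simp: minus_right)
    qed
    show "partnered (e ` {1..n} \<union> f ` {1..n}) (e ` {n+1..n+m} \<union> f ` {n+1..n+m}) p"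
      unfolding partnered_def union
    proof (intro conjI)
      show "p ` (e ` {n+1..n+m} \<union> f ` {n+1..n+m}) \<subseteq> ker_sharp scale"
        using ker by (auto simp: pe pf ker_sharp_def)
    qed (use own cross in auto)
  qed
qed

lemma darboux_card:
  assumes D: "darboux n m e f"
  shows "card (e ` {1..n} \<union> f ` {1..n}) = 2 * n"
    and "card (e ` {n+1..n+m} \<union> f ` {n+1..n+m}) = 2 * m"
proof -
  let ?K = "{1..n+m}"
  have *: "card (e ` I \<union> f ` I) = 2 * card I" if "I \<subseteq> ?K" for I
  proof -
    have "finite I" using that by (rule finite_subset) simp
    moreover have "e ` I \<inter> f ` I = {}" using that darboux_distinct(3)[OF D] by blast
    moreover have "card (e ` I) = card I" "card (f ` I) = card I"
      using inj_on_subset[OF darboux_distinct(1)[OF D] that]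
        inj_on_subset[OF darboux_distinct(2)[OF D] that] by (simp_all add: card_image)
    ultimately show ?thesis by (simp add: card_Un_disjoint)
  qed
  show "card (e ` {1..n} \<union> f ` {1..n}) = 2 * n"
    "card (e ` {n+1..n+m} \<union> f ` {n+1..n+m}) = 2 * m"
    using *[of "{1..n}"] *[of "{n+1..n+m}"] by auto
qed

text \<open>The complement is an orthogonal summand: the component of \<open>x\<close> along the system does not
  contribute to \<open>\<omega>(u, x)\<close>. Vanishing of the form on the complement can thus be turned into vanishing
  against all of \<open>V\<close>, which is what the nondegeneracy axioms ask for.\<close>

lemma form_orthogonal_reduce:
  assumes D: "darboux n m e f" and u: "u \<in> orthogonal (n+m) e f"
  obtains w where "w \<in> orthogonal (n+m) e f" "\<omega> u x = \<omega> u w"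
proof -
  let ?S1 = "e ` {1..n} \<union> f ` {1..n}" and ?S2 = "e ` {n+1..n+m} \<union> f ` {n+1..n+m}"
  obtain p where p: "partnered ?S1 ?S2 p"
    and orth: "\<And>u. (\<And>b. b \<in> e ` {1..n+m} \<union> f ` {1..n+m} \<Longrightarrow> \<omega> u (p b) = 0)
      \<Longrightarrow> u \<in> orthogonal (n+m) e f"
    using darboux_partnered[OF D] by blast
  obtain c d w where x: "x = (\<Sum>b\<in>?S1. scale (c b) b) + (\<Sum>b\<in>?S2. scale (of_real (d b)) b) + w"
    and w: "\<And>b. b \<in> ?S1 \<union> ?S2 \<Longrightarrow> \<omega> w (p b) = 0"
    using partnered_decomposition[OF p] by blast
  have union: "?S1 \<union> ?S2 = e ` {1..n+m} \<union> f ` {1..n+m}"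
    by force
  have u0: "\<omega> u b = 0" if "b \<in> ?S1 \<union> ?S2" for b
    using u that unfolding union orthogonal_def by auto
  have "(\<Sum>b\<in>?S1. c b * \<omega> u b) = 0" "(\<Sum>b\<in>?S2. of_real (d b) * \<omega> u b) = 0"
    by (rule sum.neutral, use u0 in auto)+
  then have "\<omega> u x = \<omega> u w"
    unfolding x add_right sum_right scale_right by simp
  moreover have "w \<in> orthogonal (n+m) e f"
    using w unfolding union by (rule orth)
  ultimately show thesis using that by blast
qed

text \<open>If the form vanishes on the complement, the complement lies in the radical of \<open>\<omega>\<close> and is zero.\<close>

lemma darboux_basis:
  assumes D: "darboux n m e f"
    and isotropic: "\<And>a b. a \<in> orthogonal (n+m) e f \<Longrightarrow> b \<in> orthogonal (n+m) e f \<Longrightarrow> \<omega> a b = 0"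
  shows "dual_basis scale (e ` {1..n} \<union> f ` {1..n}) (e ` {n+1..n+m} \<union> f ` {n+1..n+m})"
proof -
  let ?S1 = "e ` {1..n} \<union> f ` {1..n}" and ?S2 = "e ` {n+1..n+m} \<union> f ` {n+1..n+m}"
  obtain p where p: "partnered ?S1 ?S2 p"
    and orth: "\<And>u. (\<And>b. b \<in> e ` {1..n+m} \<union> f ` {1..n+m} \<Longrightarrow> \<omega> u (p b) = 0)
      \<Longrightarrow> u \<in> orthogonal (n+m) e f"
    using darboux_partnered[OF D] by blast
  have union: "?S1 \<union> ?S2 = e ` {1..n+m} \<union> f ` {1..n+m}"
    by force
  have "dual_spanning scale ?S1 ?S2"
    unfolding dual_spanning_def
  proof
    fix v
    obtain c d u where v: "v = (\<Sum>b\<in>?S1. scale (c b) b) + (\<Sum>b\<in>?S2. scale (of_real (d b)) b) + u"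
      and "\<And>b. b \<in> ?S1 \<union> ?S2 \<Longrightarrow> \<omega> u (p b) = 0"
      using partnered_decomposition[OF p] by blast
    then have u: "u \<in> orthogonal (n+m) e f" unfolding union by (intro orth)
    have "u = 0"
    proof (rule nondegenerate)
      fix x
      obtain w where "w \<in> orthogonal (n+m) e f" "\<omega> u x = \<omega> u w"
        using form_orthogonal_reduce[OF D u] .
      then show "\<omega> u x = 0" using isotropic[OF u] by simp
    qed
    then show "\<exists>F1 F2 c d. finite F1 \<and> F1 \<subseteq> ?S1 \<and> finite F2 \<and> F2 \<subseteq> ?S2 \<and>
        v = (\<Sum>v\<in>F1. scale (c v) v) + (\<Sum>w\<in>F2. scale (of_real (d w)) w)"
      using v by (intro exI[of _ ?S1] exI[of _ ?S2] exI[of _ c] exI[of _ d]) simp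
  qed
  moreover have "?S2 \<subseteq> ker_sharp scale"
    using D by (auto simp: darboux_def)
  ultimately show ?thesis
    using partnered_independent[OF p] by (simp add: dual_basis_def)
qed


section \<open>Enlarging Darboux systems\<close>

text \<open>A new pair is appended at index \<open>n + m + 1\<close>. Since the pairs with value \<open>1\<close> come first in the
  numbering, such a pair can be appended only while \<open>m = 0\<close>.\<close>

lemma darboux_extend:
  assumes D: "darboux n m e f"
    and ab: "a \<in> orthogonal (n+m) e f" "b \<in> orthogonal (n+m) e f"
    and new: "(m = 0 \<and> n' = Suc n \<and> m' = 0 \<and> \<omega> a b = 1) \<or>
      (n' = n \<and> m' = Suc m \<and> \<omega> a b = sharp \<and> a \<in> ker_sharp scale \<and> b \<in> ker_sharp scale)"
  shows "darboux n' m' (e(Suc (n+m) := a)) (f(Suc (n+m) := b))"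
proof -
  let ?k = "Suc (n+m)"
  have k: "n' + m' = ?k" using new by auto
  have K: "{1..?k} = insert ?k {1..n+m}" by auto
  have zero: "\<omega> a (e i) = 0" "\<omega> a (f i) = 0" "\<omega> b (e i) = 0" "\<omega> b (f i) = 0"
    "\<omega> (e i) a = 0" "\<omega> (f i) a = 0" "\<omega> (e i) b = 0" "\<omega> (f i) b = 0" if "i \<in> {1..n+m}" for i
    using ab that eq_0_sym by (auto simp: orthogonal_def)
  have old: "\<omega> (e i) (f i) = (if i \<le> n' then 1 else sharp)" if "i \<in> {1..n+m}" for i
    using D new that by (auto simp: darboux_def)
  have ker: "\<forall>i\<in>{n'+1..?k}. (e(?k := a)) i \<in> ker_sharp scale \<and> (f(?k := b)) i \<in> ker_sharp scale"
    using D new by (auto simp: darboux_def)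
  show ?thesis
    unfolding darboux_def k
  proof (intro conjI)
    show "\<forall>i\<in>{1..?k}. \<omega> ((e(?k := a)) i) ((f(?k := b)) i) = (if i \<le> n' then 1 else sharp)"
      unfolding K using old new by auto
    show "\<forall>i\<in>{1..?k}. \<forall>j\<in>{1..?k}. \<omega> ((e(?k := a)) i) ((e(?k := a)) j) = 0 \<and>
        \<omega> ((f(?k := b)) i) ((f(?k := b)) j) = 0 \<and>
        (i \<noteq> j \<longrightarrow> \<omega> ((e(?k := a)) i) ((f(?k := b)) j) = 0)"
      unfolding K using zero D by (auto simp: darboux_def)
  qed (rule ker)
qed

lemma orthogonal_scale:
  "a \<in> orthogonal k e f \<Longrightarrow> scale c a \<in> orthogonal k e f"
  by (simp add: orthogonal_def scale_left)

lemma darboux_extend_unit: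
  assumes D: "darboux n 0 e f" and ab: "a \<in> orthogonal n e f" "b \<in> orthogonal n e f"
    and nz: "Re_part (\<omega> a b) \<noteq> 0"
  shows "\<exists>e f. darboux (Suc n) 0 e f"
proof -
  obtain c where "c * \<omega> a b = 1" using left_inverse_exists[OF nz] by blast
  then have "\<omega> (scale c a) b = 1" by (simp add: scale_left)
  then have "darboux (Suc n) 0 (e(Suc (n+0) := scale c a)) (f(Suc (n+0) := b))"
    using ab by (intro darboux_extend[OF D]) (simp_all add: orthogonal_scale)
  then show ?thesis by blast
qed

lemma darboux_extend_sharp:
  assumes D: "darboux n m e f" and ab: "a \<in> orthogonal (n+m) e f" "b \<in> orthogonal (n+m) e f"
    and ker: "a \<in> ker_sharp scale" "b \<in> ker_sharp scale" and nz: "\<omega> a b \<noteq> 0"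
  shows "\<exists>e f. darboux n (Suc m) e f"
proof -
  define s where "s = Sharp_part (\<omega> a b)"
  have ab_eq: "\<omega> a b = of_real s * sharp"
    unfolding s_def using Re_form_ker[OF ker(2)] by (rule eq_of_real_mult_sharp)
  with nz have "s \<noteq> 0" by auto
  then have "\<omega> (scale (of_real (1 / s)) a) b = sharp"
    by (simp add: scale_left ab_eq dual_real_eq_iff)
  moreover have "scale (of_real (1 / s)) a \<in> ker_sharp scale"
    using ker(1) unfolding ker_sharp_def by (simp add: scale_left_commute[of sharp] del: scale_scale)
  ultimately have "darboux n (Suc m) (e(Suc (n+m) := scale (of_real (1 / s)) a)) (f(Suc (n+m) := b))"
    using ab ker(2) by (intro darboux_extend[OF D]) (simp_all add: orthogonal_scale)
  then show ?thesis by blast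
qed

text \<open>The passage from the first round to the second. The first \<open>n\<close> pairs alone form a maximal
  system of pairs with value \<open>1\<close>, so the real part of \<open>\<omega>\<close> vanishes on their complement, hence
  against all of \<open>V\<close>, and axiom (iv) applies. The complement of the whole system is smaller.\<close>

lemma orthogonal_subset_ker:
  assumes D: "darboux n m e f" and maximal: "\<nexists>e f. darboux (Suc n) 0 e f"
  shows "orthogonal (n+m) e f \<subseteq> ker_sharp scale"
proof
  fix u assume "u \<in> orthogonal (n+m) e f"
  then have u: "u \<in> orthogonal n e f" by (auto simp: orthogonal_def)
  have D0: "darboux n 0 e f" using D by (auto simp: darboux_def)
  show "u \<in> ker_sharp scale"
  proof (rule Re_radical)
    fix x
    obtain w where "w \<in> orthogonal n e f" "\<omega> u x = \<omega> u w"
      using form_orthogonal_reduce[OF D0, of u x] u by auto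
    then show "Re_part (\<omega> u x) = 0"
      using darboux_extend_unit[OF D0 u] maximal by metis
  qed
qed

lemma darboux_bounded:
  assumes "dual_finite_dimensional scale"
  shows "\<exists>N. \<forall>n m e f. darboux n m e f \<longrightarrow> n \<le> N \<and> m \<le> N"
proof -
  obtain N where N: "\<forall>S1 S2. dual_independent scale S1 S2 \<longrightarrow> finite S1 \<longrightarrow> finite S2 \<longrightarrow>
      2 * card S1 + card S2 \<le> N"
    using dual_independent_card_bound[OF assms] ..
  show ?thesis
  proof (rule exI[of _ N], intro allI impI)
    fix n m e f assume D: "darboux n m e f"
    let ?S1 = "e ` {1..n} \<union> f ` {1..n}" and ?S2 = "e ` {n+1..n+m} \<union> f ` {n+1..n+m}"
    obtain p where "partnered ?S1 ?S2 p"
      using darboux_partnered[OF D] by blast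
    then have "2 * card ?S1 + card ?S2 \<le> N"
      using N partnered_independent by simp
    then show "n \<le> N \<and> m \<le> N"
      unfolding darboux_card[OF D] by simp
  qed
qed

text \<open>Here \<open>n\<close> is chosen first, as large as possible for systems without \<open>1\<^sup>#\<close>-pairs, and then \<open>m\<close>
  for this \<open>n\<close>. The vectors of the first round need not be kept in the second, because
  \<open>orthogonal_subset_ker\<close> applies to every system with this value of \<open>n\<close>.\<close>

lemma darboux_basis_exists:
  assumes "dual_finite_dimensional scale"
  obtains n m e f where "darboux n m e f"
    "dual_basis scale (e ` {1..n} \<union> f ` {1..n}) (e ` {n+1..n+m} \<union> f ` {n+1..n+m})"
proof -
  obtain N where N: "\<forall>n m e f. darboux n m e f \<longrightarrow> n \<le> N \<and> m \<le> N"
    using darboux_bounded[OF assms] ..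
  \<comment> \<open>a predicate that holds at \<open>0\<close> and is bounded by \<open>N\<close> stops at some \<open>k\<close>; used once for \<open>n\<close> and once for \<open>m\<close>\<close>
  have last: "\<exists>k. P k \<and> \<not> P (Suc k)" if "P 0" "\<And>k. P k \<Longrightarrow> k \<le> N" for P
  proof (rule ccontr)
    assume "\<nexists>k. P k \<and> \<not> P (Suc k)"
    then have "P k" for k using \<open>P 0\<close> by (induction k) auto
    then show False using that(2)[of "Suc N"] by simp
  qed
  have "darboux 0 0 e f" for e f by (simp add: darboux_def)
  then have "\<exists>n. (\<exists>e f. darboux n 0 e f) \<and> (\<nexists>e f. darboux (Suc n) 0 e f)"
    using N by (intro last) auto
  then obtain n where n: "\<exists>e f. darboux n 0 e f" and n_max: "\<nexists>e f. darboux (Suc n) 0 e f"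
    by auto
  have "\<exists>m. (\<exists>e f. darboux n m e f) \<and> (\<nexists>e f. darboux n (Suc m) e f)"
    using N n by (intro last) auto
  then obtain m e f where D: "darboux n m e f" and m_max: "\<nexists>e f. darboux n (Suc m) e f"
    by auto
  have "\<omega> a b = 0" if "a \<in> orthogonal (n+m) e f" "b \<in> orthogonal (n+m) e f" for a b
    using darboux_extend_sharp[OF D that] orthogonal_subset_ker[OF D n_max] m_max that by blast
  from that[OF D darboux_basis[OF D this]] show thesis .
qed

end

theorem proposition3p1:
  fixes scale :: "dual_real \<Rightarrow> 'v::ab_group_add \<Rightarrow> 'v"
    and \<omega> :: "'v \<Rightarrow> 'v \<Rightarrow> dual_real"
  assumes "symplectic_dual_module scale \<omega>"
    and "dual_finite_dimensional scale"
  shows "\<exists>(n::nat) (m::nat). dual_dim scale = (2 * n, 2 * m) \<and>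
    (\<exists>(e :: nat \<Rightarrow> 'v) (f :: nat \<Rightarrow> 'v).
      dual_basis scale (e ` {1..n} \<union> f ` {1..n}) (e ` {n+1..n+m} \<union> f ` {n+1..n+m}) \<and>
      (\<forall>i\<in>{1..n}. \<omega> (e i) (f i) = 1) \<and>
      (\<forall>j\<in>{1..m}. \<omega> (e (n + j)) (f (n + j)) = sharp) \<and>
      (\<forall>i\<in>{1..n+m}. \<forall>j\<in>{1..n+m}. \<omega> (e i) (e j) = 0) \<and>
      (\<forall>i\<in>{1..n+m}. \<forall>j\<in>{1..n+m}. \<omega> (f i) (f j) = 0) \<and>
      (\<forall>i\<in>{1..n+m}. \<forall>j\<in>{1..n+m}. i \<noteq> j \<longrightarrow> \<omega> (e i) (f j) = 0))"
proof -
  interpret symplectic_dual_module scale \<omega> by fact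
  obtain n m e f where D: "darboux n m e f"
    and basis: "dual_basis scale (e ` {1..n} \<union> f ` {1..n}) (e ` {n+1..n+m} \<union> f ` {n+1..n+m})"
    using darboux_basis_exists[OF assms(2)] .
  have "dual_dim scale = (2 * n, 2 * m)"
    using dual_dim_eq[OF basis] darboux_card[OF D] by simp
  moreover have "\<forall>i\<in>{1..n}. \<omega> (e i) (f i) = 1" "\<forall>j\<in>{1..m}. \<omega> (e (n + j)) (f (n + j)) = sharp"
    "\<forall>i\<in>{1..n+m}. \<forall>j\<in>{1..n+m}. \<omega> (e i) (e j) = 0"
    "\<forall>i\<in>{1..n+m}. \<forall>j\<in>{1..n+m}. \<omega> (f i) (f j) = 0"
    "\<forall>i\<in>{1..n+m}. \<forall>j\<in>{1..n+m}. i \<noteq> j \<longrightarrow> \<omega> (e i) (f j) = 0"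
    using D by (auto simp: darboux_def)
  ultimately show ?thesis using basis by blast
qed

end
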